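(* Let $T\ge1$ be an integer and let $f:[1,T]\times\mathbb{R}\to\mathbb{R}$ be such that $y\mapsto f(t,y)$ is continuous for each $t\in[1,T]$. Suppose there is a constant $M>0$ such that $$f(t,w)-f(t,y)\ge M(w-y)\qquad\text{for all } t\in[1,T]\text{ and all } y,w\in\mathbb{R},$$ and $M<\lambda_1$, where $\lambda_1=2-2\cos\left(\frac{\pi}{T+1}\right)$. Then the discrete boundary value problem $$-\Delta^2y(t-1)=f(t,y(t)),\quad t\in[1,T],\qquad y(0)=0,\quad y(T+1)=0,$$ has a unique solution $y:[0,T+1]\to\mathbb{R}$.
   Context: For integers $a\le b$, $[a,b]$ denotes the discrete interval $\{a,a+1,\dots,b\}$. $\Delta$ is the forward difference operator, $\Delta y(t)=y(t+1)-y(t)$, so $\Delta^2y(t-1)=y(t+1)-2y(t)+y(t-1)$. The number $\lambda_1$ is the first eigenvalue of $\Delta^2y(t-1)+\lambda y(t)=0$ on $[1,T]$, $y(0)=y(T+1)=0$. The inequality on $f$ is a two-sided condition: no ordering between $y$ and $w$ is imposed. *)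

theory Defs
  imports Complex_Main "HOL-Library.FuncSet"
begin

definition fwd_diff :: "(nat \<Rightarrow> real) \<Rightarrow> nat \<Rightarrow> real" where
  "fwd_diff y t = y (t + 1) - y t"

text \<open>
  The second difference is only ever evaluated at \<open>t - 1\<close> with \<open>t \<ge> 1\<close>, so the truncated
  subtraction on natural numbers agrees with the subtraction of integers.
\<close>

definition bvp_solution :: "nat \<Rightarrow> (nat \<Rightarrow> real \<Rightarrow> real) \<Rightarrow> (nat \<Rightarrow> real) \<Rightarrow> bool" where
  "bvp_solution T f y \<longleftrightarrow>
     (\<forall>t\<in>{1..T}. - fwd_diff (fwd_diff y) (t - 1) = f t (y t)) \<and> y 0 = 0 \<and> y (T + 1) = 0"

definition lambda1 :: "nat \<Rightarrow> real" where
  "lambda1 T = 2 - 2 * cos (pi / (real T + 1))"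

definition dirichlet_eigenvalue :: "nat \<Rightarrow> real \<Rightarrow> bool" where
  "dirichlet_eigenvalue T l \<longleftrightarrow>
     (\<exists>y. (\<forall>t\<in>{1..T}. fwd_diff (fwd_diff y) (t - 1) + l * y t = 0) \<and> y 0 = 0 \<and> y (T + 1) = 0 \<and>
          (\<exists>t\<in>{1..T}. y t \<noteq> 0))"

lemma fwd_diff2:
  assumes "t \<ge> 1"
  shows "fwd_diff (fwd_diff y) (t - 1) = y (t + 1) - 2 * y t + y (t - 1)"
  using assms by (simp add: fwd_diff_def)

text \<open>
  The closed form \<^const>\<open>lambda1\<close> is the first eigenvalue of the Dirichlet problem.  An eigenfunction
  is compared with the positive function \<open>sin (\<pi> t / (T + 1))\<close> at a point where their quotient
  is largest.
\<close>

lemma lambda1_first_eigenvalue: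
  assumes "T \<ge> 1"
  shows "dirichlet_eigenvalue T (lambda1 T)"
    and "dirichlet_eigenvalue T l \<Longrightarrow> lambda1 T \<le> l"
proof -
  define a where "a = pi / (real T + 1)"
  define p where "p = (\<lambda>t::nat. sin (a * real t))"
  have aT: "a * real (T + 1) = pi" by (simp add: a_def field_simps)
  have a0: "a > 0" by (simp add: a_def)
  have p0: "p 0 = 0" "p (T + 1) = 0" unfolding p_def aT by simp_all
  have ppos: "p t > 0" if "t \<in> {1..T}" for t
  proof -
    have "a * real t < a * real (T + 1)" using that a0 by (intro mult_strict_left_mono) auto
    then have "a * real t < pi" by (simp only: aT)
    then show ?thesis unfolding p_def using that a0 by (intro sin_gt_zero) auto
  qed
  have prec: "p (t + 1) + p (t - 1) = (2 - lambda1 T) * p t" if "t \<in> {1..T}" for t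
  proof -
    have "a * real (t - 1) = a * real t - a" "a * real (t + 1) = a * real t + a"
      using that by (auto simp: of_nat_diff algebra_simps)
    then show ?thesis
      unfolding p_def lambda1_def a_def[symmetric] by (simp add: sin_add sin_diff)
  qed
  have "fwd_diff (fwd_diff p) (t - 1) + lambda1 T * p t = 0" if "t \<in> {1..T}" for t
    using prec[OF that] fwd_diff2[of t p] that by (simp add: algebra_simps)
  moreover have "\<exists>t\<in>{1..T}. p t \<noteq> 0"
    using ppos[of 1] assms by (intro bexI[of _ 1]) auto
  ultimately show "dirichlet_eigenvalue T (lambda1 T)"
    unfolding dirichlet_eigenvalue_def using p0 by blast
  assume "dirichlet_eigenvalue T l"
  then obtain y s where y: "\<And>t. t \<in> {1..T} \<Longrightarrow> fwd_diff (fwd_diff y) (t - 1) + l * y t = 0"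
    and y0: "y 0 = 0" "y (T + 1) = 0" and s: "s \<in> {1..T}" "y s \<noteq> 0"
    unfolding dirichlet_eigenvalue_def by blast
  have yrec: "y (t + 1) + y (t - 1) = (2 - l) * y t" if "t \<in> {1..T}" for t
    using y[OF that] fwd_diff2[of t y] that by (simp add: algebra_simps)
  define z where "z = (\<lambda>t. sgn (y s) * y t)"
  have zrec: "z (t + 1) + z (t - 1) = (2 - l) * z t" if "t \<in> {1..T}" for t
    using yrec[OF that] unfolding z_def by (metis (no_types) distrib_left mult.left_commute)
  have z0: "z 0 = 0" "z (T + 1) = 0" and zs: "z s > 0"
    using y0 s by (auto simp: z_def sgn_if)
  define u where "u = Max ((\<lambda>t. z t / p t) ` {1..T})"
  have "u \<in> (\<lambda>t. z t / p t) ` {1..T}" unfolding u_def using assms by (intro Max_in) auto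
  then obtain m where m: "m \<in> {1..T}" and um: "u = z m / p m" by blast
  have ub: "z t / p t \<le> u" if "t \<in> {1..T}" for t unfolding u_def using that by (intro Max_ge) auto
  have "z s / p s > 0" using zs ppos[OF s(1)] by simp
  then have upos: "u > 0" using ub[OF s(1)] by linarith
  have le: "z t \<le> u * p t" if "t \<le> T + 1" for t
  proof (cases "t \<in> {1..T}")
    case True
    then show ?thesis using ub[OF True] ppos[OF True] by (simp add: field_simps)
  next
    case False
    then have "t = 0 \<or> t = T + 1" using that by auto
    then show ?thesis using z0 p0 by auto
  qed
  have zm: "z m = u * p m" using um ppos[OF m] by simp
  have "(2 - l) * (u * p m) = z (m + 1) + z (m - 1)" using zrec[OF m] zm by simp
  also have "\<dots> \<le> u * p (m + 1) + u * p (m - 1)" using m by (intro add_mono le) auto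
  also have "\<dots> = (2 - lambda1 T) * (u * p m)"
    using prec[OF m] by (metis (no_types) distrib_left mult.left_commute)
  finally show "lambda1 T \<le> l" using upos ppos[OF m] by (simp add: mult_le_cancel_right)
qed

end

theory Submission
  imports Defs
begin

text \<open>
  Exchanging \<open>y\<close> and \<open>w\<close> in the two-sided inequality turns it into an equality, so
  \<open>f t\<close> is affine with slope \<open>M\<close>.  The problem is thus linear, and it is uniquely solvable
  because \<open>M\<close> lies below the first Dirichlet eigenvalue; existence is obtained by shooting from
  \<open>y 0 = 0\<close> and adjusting the initial slope.
\<close>

text \<open>The equation \<open>-y(t+1) + 2 y(t) - y(t-1) = g t + M * y t\<close> solved for
  \<open>y(t+1)\<close>. Since the value at 0 is 0, \<open>c\<close> is the initial slope.\<close>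

fun shoot :: "real \<Rightarrow> (nat \<Rightarrow> real) \<Rightarrow> real \<Rightarrow> nat \<Rightarrow> real" where
  "shoot M g c 0 = 0"
| "shoot M g c (Suc 0) = c"
| "shoot M g c (Suc (Suc n)) = (2 - M) * shoot M g c (Suc n) - shoot M g c n - g (Suc n)"

lemma shoot_rec:
  assumes "t \<ge> 1"
  shows "shoot M g c (t + 1) = (2 - M) * shoot M g c t - shoot M g c (t - 1) - g t"
  using assms by (cases t) auto

text \<open>A solution with a nonzero interior value would be an eigenfunction for \<open>M\<close>.
  Existence and uniqueness both rest on this.\<close>

lemma not_eigenvalue_imp_zero:
  assumes "\<not> dirichlet_eigenvalue T M"
    and "\<And>t. t \<in> {1..T} \<Longrightarrow> y (t + 1) = (2 - M) * y t - y (t - 1)"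
    and "y 0 = 0" "y (T + 1) = 0" "t \<le> T + 1"
  shows "y t = 0"
proof -
  have "fwd_diff (fwd_diff y) (t - 1) + M * y t = 0" if "t \<in> {1..T}" for t
    using assms(2)[OF that] fwd_diff2[of t y] that by (simp add: algebra_simps)
  then have "\<forall>t\<in>{1..T}. y t = 0"
    using assms(1,3,4) unfolding dirichlet_eigenvalue_def by blast
  moreover have "t = 0 \<or> t = T + 1 \<or> t \<in> {1..T}" using assms(5) by auto
  ultimately show ?thesis using assms(3,4) by blast
qed

lemma bvp_solution_affine_iff:
  assumes "\<And>t x. t \<in> {1..T} \<Longrightarrow> f t x = g t + M * x"
  shows "bvp_solution T f y \<longleftrightarrow>
    (\<forall>t\<in>{1..T}. y (t + 1) = (2 - M) * y t - y (t - 1) - g t) \<and> y 0 = 0 \<and> y (T + 1) = 0"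
proof -
  have "- fwd_diff (fwd_diff y) (t - 1) = f t (y t) \<longleftrightarrow>
      y (t + 1) = (2 - M) * y t - y (t - 1) - g t" if "t \<in> {1..T}" for t
    using fwd_diff2[of t y] that assms[OF that, of "y t"] by (auto simp: algebra_simps)
  then show ?thesis unfolding bvp_solution_def by auto
qed

lemma affine_bvp_solution_exists:
  assumes "T \<ge> 1" and "\<not> dirichlet_eigenvalue T M"
    and "\<And>t x. t \<in> {1..T} \<Longrightarrow> f t x = g t + M * x"
  shows "\<exists>y. bvp_solution T f y"
proof -
  \<comment> \<open>Superposition: \<open>p\<close> carries the inhomogeneity \<open>g\<close>,
    while \<open>h\<close> solves the homogeneous equation, so subtracting a multiple of
    \<open>h\<close> keeps the equation and the value at 0.\<close>
  define p where "p = shoot M g 0"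
  define h where "h = shoot M (\<lambda>_. 0) 1"
  have prec: "p (t + 1) = (2 - M) * p t - p (t - 1) - g t" if "t \<in> {1..T}" for t
    using shoot_rec[of t] that unfolding p_def by simp
  have hrec: "h (t + 1) = (2 - M) * h t - h (t - 1)" if "t \<in> {1..T}" for t
    using shoot_rec[of t M "\<lambda>_. 0"] that unfolding h_def by simp
  have init: "p 0 = 0" "h 0 = 0" "h 1 = 1" by (simp_all add: p_def h_def)
  \<comment> \<open>Otherwise \<open>h\<close> would solve the homogeneous boundary value problem
    and vanish identically, against \<open>h 1 = 1\<close>.\<close>
  have hT: "h (T + 1) \<noteq> 0"
    using not_eigenvalue_imp_zero[OF assms(2) hrec init(2), of 1] init(3) assms(1) by auto
  have iff: "bvp_solution T f y \<longleftrightarrow>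
    (\<forall>t\<in>{1..T}. y (t + 1) = (2 - M) * y t - y (t - 1) - g t) \<and> y 0 = 0 \<and> y (T + 1) = 0" for y
    using assms(3) by (rule bvp_solution_affine_iff)
  \<comment> \<open>The multiple of \<open>h\<close> that cancels \<open>p\<close> at the right end
    point.\<close>
  define k where "k = p (T + 1) / h (T + 1)"
  have "bvp_solution T f (\<lambda>t. p t - k * h t)"
    unfolding iff
  proof (intro conjI ballI)
    fix t assume t: "t \<in> {1..T}"
    show "p (t + 1) - k * h (t + 1) =
        (2 - M) * (p t - k * h t) - (p (t - 1) - k * h (t - 1)) - g t"
      unfolding prec[OF t] hrec[OF t] by (simp add: algebra_simps)
  next
    show "p 0 - k * h 0 = 0" using init by simp
    show "p (T + 1) - k * h (T + 1) = 0" using hT by (simp add: k_def)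
  qed
  then show ?thesis by blast
qed

text \<open>The term \<open>g\<close> cancels in the difference of two solutions, which therefore
  solves the homogeneous problem.\<close>

lemma affine_bvp_solution_unique:
  assumes "\<not> dirichlet_eigenvalue T M"
    and "\<And>t x. t \<in> {1..T} \<Longrightarrow> f t x = g t + M * x"
    and "bvp_solution T f y" "bvp_solution T f z" "t \<le> T + 1"
  shows "y t = z t"
proof -
  have iff: "bvp_solution T f y \<longleftrightarrow>
    (\<forall>t\<in>{1..T}. y (t + 1) = (2 - M) * y t - y (t - 1) - g t) \<and> y 0 = 0 \<and> y (T + 1) = 0" for y
    using assms(2) by (rule bvp_solution_affine_iff)
  have "y s - z s = 0" if "s \<le> T + 1" for s
  proof (rule not_eigenvalue_imp_zero[OF assms(1) _ _ _ that, where y = "\<lambda>s. y s - z s"])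
    fix r assume "r \<in> {1..T}"
    then have "y (r + 1) = (2 - M) * y r - y (r - 1) - g r"
      "z (r + 1) = (2 - M) * z r - z (r - 1) - g r"
      using assms(3,4) iff by blast+
    then show "y (r + 1) - z (r + 1) = (2 - M) * (y r - z r) - (y (r - 1) - z (r - 1))"
      by (simp add: algebra_simps)
  qed (use assms(3,4) iff in auto)
  then show ?thesis using assms(5) by simp
qed

text \<open>The problem reads \<open>y\<close> only on \<open>{0..T + 1}\<close>; restricting fixes
  the values elsewhere, so that uniqueness can hold as equality of functions.\<close>

lemma bvp_solution_restrict:
  assumes "bvp_solution T f y"
  shows "bvp_solution T f (restrict y {0..T + 1})"
  using assms by (auto simp: bvp_solution_def fwd_diff_def)

theorem theorem4p2:
  fixes T :: nat and f :: "nat \<Rightarrow> real \<Rightarrow> real" and M :: real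
  assumes "T \<ge> 1"
    and "\<And>t. t \<in> {1..T} \<Longrightarrow> continuous_on UNIV (f t)"
    and "M > 0"
    and "\<And>t y w. t \<in> {1..T} \<Longrightarrow> f t w - f t y \<ge> M * (w - y)"
    and "M < lambda1 T"
  shows "\<exists>!y. y \<in> {0..T + 1} \<rightarrow>\<^sub>E (UNIV :: real set) \<and> bvp_solution T f y"
proof -
  \<comment> \<open>Comparing \<open>x\<close> with 0 in both orders bounds
    \<open>f t x - f t 0\<close> by \<open>M * x\<close> from both sides.\<close>
  have affine: "f t x = f t 0 + M * x" if "t \<in> {1..T}" for t x
    using assms(4)[OF that, of 0 x] assms(4)[OF that, of x 0] by (simp add: algebra_simps)
  have not_ev: "\<not> dirichlet_eigenvalue T M"
    using lambda1_first_eigenvalue(2)[OF assms(1), of M] assms(5) by auto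
  obtain y where y: "bvp_solution T f y"
    using affine_bvp_solution_exists[of T M f "\<lambda>t. f t 0", OF assms(1) not_ev affine] by blast
  show ?thesis
  proof (rule ex1I)
    show "restrict y {0..T + 1} \<in> {0..T + 1} \<rightarrow>\<^sub>E UNIV \<and> bvp_solution T f (restrict y {0..T + 1})"
      using bvp_solution_restrict[OF y] by auto
  next
    fix z assume z: "z \<in> {0..T + 1} \<rightarrow>\<^sub>E (UNIV :: real set) \<and> bvp_solution T f z"
    show "z = restrict y {0..T + 1}"
    proof
      fix t
      show "z t = restrict y {0..T + 1} t"
      proof (cases "t \<in> {0..T + 1}")
        case True
        then show ?thesis
          using affine_bvp_solution_unique[of T M f "\<lambda>t. f t 0" z y t, OF not_ev affine] z y by simp
      next
        case False
        \<comment> \<open>Off the interval both functions take the value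
          \<open>undefined\<close>.\<close>
        then show ?thesis using z PiE_arb[of z "{0..T + 1}" _ t] by (metis restrict_apply)
      qed
    qed
  qed
qed

end
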